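(* Let $n\ge 1$ and $\gamma>0$. Let $f$ be an analytic function on $\mathbb{B}_n$ and $\varphi$ an analytic self-map of $\mathbb{B}_n$. Then $W_{f,\varphi}$ is a non-zero self-adjoint bounded operator on $H_{\gamma}$ if and only if there is a vector $c\in\mathbb{B}_n$, a self-adjoint linear operator $A$ on $\mathbb{C}^n$ and a non-zero real number $\alpha$ such that $f=\alpha K^{\gamma}_{c}=\alpha K^{\gamma}_{\varphi(0)}$ and $\varphi(z)=\dfrac{c+Az}{1-\langle z,c\rangle}$ for $z\in\mathbb{B}_n$.
   Context: $\mathbb{B}_n$ is the open unit ball of $\mathbb{C}^n$, with $\langle z,w\rangle=\sum_j z_j\overline{w_j}$. For $\gamma>0$, $H_{\gamma}$ is the Hilbert space of analytic functions on $\mathbb{B}_n$ with reproducing kernel $K^{\gamma}_z(w)=(1-\langle w,z\rangle)^{-\gamma}$ (principal branch). For $f$ analytic on $\mathbb{B}_n$ and $\varphi$ an analytic self-map of $\mathbb{B}_n$, $W_{f,\varphi}h=f\cdot(h\circ\varphi)$; it is bounded on $H_\gamma$ if it maps $H_\gamma$ into $H_\gamma$ as a bounded operator. *)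

theory Defs
  imports "HOL-Analysis.Analysis"
begin

text \<open>
  A Hilbert space of complex-valued functions on a set \<open>X\<close> is given by a set \<open>H\<close> of total functions
  and an inner product on \<open>H\<close>. Functions on \<open>X\<close> are represented by total functions vanishing
  outside \<open>X\<close>, so that equality of elements of \<open>H\<close> is equality on \<open>X\<close>.
  The inner product is linear in its first argument; its values outside \<open>H\<close> are irrelevant.
\<close>

definition ip_norm :: "(('a \<Rightarrow> complex) \<Rightarrow> ('a \<Rightarrow> complex) \<Rightarrow> complex) \<Rightarrow> ('a \<Rightarrow> complex) \<Rightarrow> real" where
  "ip_norm ip h = sqrt (Re (ip h h))"

locale function_hilbert_space =
  fixes X :: "'a set"
    and H :: "('a \<Rightarrow> complex) set"
    and ip :: "('a \<Rightarrow> complex) \<Rightarrow> ('a \<Rightarrow> complex) \<Rightarrow> complex"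
  assumes vanishes_outside: "h \<in> H \<Longrightarrow> x \<notin> X \<Longrightarrow> h x = 0"
    and zero_mem: "(\<lambda>x. 0) \<in> H"
    and add_mem: "g \<in> H \<Longrightarrow> h \<in> H \<Longrightarrow> (\<lambda>x. g x + h x) \<in> H"
    and scale_mem: "h \<in> H \<Longrightarrow> (\<lambda>x. a * h x) \<in> H"
    and ip_add_left:
      "g \<in> H \<Longrightarrow> h \<in> H \<Longrightarrow> k \<in> H \<Longrightarrow> ip (\<lambda>x. g x + h x) k = ip g k + ip h k"
    and ip_scale_left: "h \<in> H \<Longrightarrow> k \<in> H \<Longrightarrow> ip (\<lambda>x. a * h x) k = a * ip h k"
    and ip_commute: "h \<in> H \<Longrightarrow> k \<in> H \<Longrightarrow> ip k h = cnj (ip h k)"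
    and ip_pos: "h \<in> H \<Longrightarrow> h \<noteq> (\<lambda>x. 0) \<Longrightarrow> Re (ip h h) > 0"
    and complete:
      "(\<And>m. s m \<in> H) \<Longrightarrow>
       (\<And>e. e > 0 \<Longrightarrow> \<exists>N. \<forall>i\<ge>N. \<forall>j\<ge>N. ip_norm ip (\<lambda>x. s i x - s j x) < e) \<Longrightarrow>
       \<exists>h\<in>H. (\<lambda>m. ip_norm ip (\<lambda>x. s m x - h x)) \<longlonglongrightarrow> 0"

text \<open>In the kernel \<open>K\<close>, the first argument is the base point: \<open>K z\<close> is the function written
  \<open>K\<^sub>z\<close> on paper.\<close>

locale reproducing_kernel_hilbert_space = function_hilbert_space X H ip
  for X :: "'a set"
    and H :: "('a \<Rightarrow> complex) set"
    and ip :: "('a \<Rightarrow> complex) \<Rightarrow> ('a \<Rightarrow> complex) \<Rightarrow> complex" +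
  fixes K :: "'a \<Rightarrow> 'a \<Rightarrow> complex"
  assumes kernel_mem: "z \<in> X \<Longrightarrow> K z \<in> H"
    and reproducing: "z \<in> X \<Longrightarrow> h \<in> H \<Longrightarrow> ip h (K z) = h z"

definition bounded_operator_on ::
  "('a \<Rightarrow> complex) set \<Rightarrow> (('a \<Rightarrow> complex) \<Rightarrow> ('a \<Rightarrow> complex) \<Rightarrow> complex) \<Rightarrow>
   (('a \<Rightarrow> complex) \<Rightarrow> ('a \<Rightarrow> complex)) \<Rightarrow> bool" where
  "bounded_operator_on H ip T \<longleftrightarrow>
     (\<forall>h\<in>H. T h \<in> H) \<and>
     (\<forall>g\<in>H. \<forall>h\<in>H. T (\<lambda>x. g x + h x) = (\<lambda>x. T g x + T h x)) \<and>
     (\<forall>a. \<forall>h\<in>H. T (\<lambda>x. a * h x) = (\<lambda>x. a * T h x)) \<and>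
     (\<exists>C. \<forall>h\<in>H. ip_norm ip (T h) \<le> C * ip_norm ip h)"

definition self_adjoint_operator_on ::
  "('a \<Rightarrow> complex) set \<Rightarrow> (('a \<Rightarrow> complex) \<Rightarrow> ('a \<Rightarrow> complex) \<Rightarrow> complex) \<Rightarrow>
   (('a \<Rightarrow> complex) \<Rightarrow> ('a \<Rightarrow> complex)) \<Rightarrow> bool" where
  "self_adjoint_operator_on H ip T \<longleftrightarrow> (\<forall>h\<in>H. \<forall>k\<in>H. ip (T h) k = ip h (T k))"

definition nonzero_operator_on ::
  "('a \<Rightarrow> complex) set \<Rightarrow> (('a \<Rightarrow> complex) \<Rightarrow> ('a \<Rightarrow> complex)) \<Rightarrow> bool" where
  "nonzero_operator_on H T \<longleftrightarrow> (\<exists>h\<in>H. T h \<noteq> (\<lambda>x. 0))"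

text \<open>The norm of \<^typ>\<open>complex ^ 'n\<close> is the Euclidean one, so the open unit ball of complex
  \<open>n\<close>-space is \<^term>\<open>ball 0 1\<close>. The library inner product on this type is only the real part of
  the Hermitian one.\<close>

abbreviation unit_ball :: "(complex ^ 'n) set" where
  "unit_ball \<equiv> ball 0 1"

definition cinner :: "complex ^ 'n \<Rightarrow> complex ^ 'n \<Rightarrow> complex" where
  "cinner z w = (\<Sum>j\<in>UNIV. z $ j * cnj (w $ j))"

text \<open>Analyticity in several complex variables: at every point of the (open) set the function has
  a Frechet derivative that is complex linear.\<close>

definition analytic_several :: "(complex ^ 'n \<Rightarrow> complex) \<Rightarrow> (complex ^ 'n) set \<Rightarrow> bool" where
  "analytic_several f S \<longleftrightarrow>
     (\<forall>z\<in>S. \<exists>D. (f has_derivative D) (at z) \<and> (\<forall>a v. D (a *s v) = a * D v))"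

definition analytic_self_map :: "(complex ^ 'n \<Rightarrow> complex ^ 'n) \<Rightarrow> bool" where
  "analytic_self_map \<phi> \<longleftrightarrow>
     (\<forall>j. analytic_several (\<lambda>z. \<phi> z $ j) unit_ball) \<and> \<phi> ` unit_ball \<subseteq> unit_ball"

text \<open>The complex \<^const>\<open>powr\<close> is the principal branch.\<close>

definition ball_kernel :: "real \<Rightarrow> complex ^ 'n \<Rightarrow> complex ^ 'n \<Rightarrow> complex" where
  "ball_kernel \<gamma> z w =
     (if w \<in> unit_ball then (1 - cinner w z) powr (- complex_of_real \<gamma>) else 0)"

text \<open>\<open>H\<close> with inner product \<open>ip\<close> is the Hilbert space of analytic functions on the unit ball with
  reproducing kernel \<^term>\<open>ball_kernel \<gamma>\<close>; a Hilbert function space is determined by its kernel.\<close>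

definition is_H_gamma ::
  "real \<Rightarrow> (complex ^ 'n \<Rightarrow> complex) set \<Rightarrow>
   ((complex ^ 'n \<Rightarrow> complex) \<Rightarrow> (complex ^ 'n \<Rightarrow> complex) \<Rightarrow> complex) \<Rightarrow> bool" where
  "is_H_gamma \<gamma> H ip \<longleftrightarrow>
     reproducing_kernel_hilbert_space unit_ball H ip (ball_kernel \<gamma>) \<and>
     (\<forall>h\<in>H. analytic_several h unit_ball)"

definition weighted_composition ::
  "(complex ^ 'n \<Rightarrow> complex) \<Rightarrow> (complex ^ 'n \<Rightarrow> complex ^ 'n) \<Rightarrow>
   (complex ^ 'n \<Rightarrow> complex) \<Rightarrow> (complex ^ 'n \<Rightarrow> complex)" where
  "weighted_composition f \<phi> h = (\<lambda>z. if z \<in> unit_ball then f z * h (\<phi> z) else 0)"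

definition self_adjoint_linear :: "(complex ^ 'n \<Rightarrow> complex ^ 'n) \<Rightarrow> bool" where
  "self_adjoint_linear A \<longleftrightarrow>
     Vector_Spaces.linear (*s) (*s) A \<and> (\<forall>z w. cinner (A z) w = cinner z (A w))"

end

theory Submission
  imports Defs
begin

text \<open>
  Self-adjointness tested on kernels reads
  \<open>f w * K z (\<phi> w) = cnj (f z) * K (\<phi> z) w\<close>. Taking \<open>z = 0\<close> gives \<open>f\<close>, and removing the
  exponent \<open>-\<gamma>\<close> leaves
  \<open>(1 - \<langle>w,c\<rangle>) (1 - \<langle>\<phi> w,z\<rangle>) = (1 - \<langle>c,z\<rangle>) (1 - \<langle>w,\<phi> z\<rangle>)\<close> with \<open>c = \<phi> 0\<close>. This says that
  \<open>z \<mapsto> (1 - \<langle>z,c\<rangle>) \<phi> z - c\<close> is symmetric, hence linear.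

  Conversely, the same relation makes the operator \<open>W\<close> symmetric on the span of the kernels, which
  it maps into itself. At \<open>w = \<phi> z\<close> the relation also yields \<open>1 - |\<phi> z| \<ge> r (1 - |z|)\<close>, so for
  each \<open>h\<close> in the span \<open>\<parallel>W\<^sup>m h\<parallel>\<close> grows at most like \<open>M\<^sup>m\<close> with \<open>M\<close> independent of \<open>h\<close>. For a
  symmetric operator this forces \<open>\<parallel>W h\<parallel> \<le> M \<parallel>h\<parallel>\<close>, and density of the span extends the bound to
  the whole space.
\<close>

subsection \<open>Hilbert spaces of functions\<close>

context function_hilbert_space
begin

lemma diff_mem: "g \<in> H \<Longrightarrow> h \<in> H \<Longrightarrow> (\<lambda>x. g x - h x) \<in> H"
  using add_mem[of g "\<lambda>x. (-1) * h x"] scale_mem[of h "-1"] by simp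

lemma ip_zero_left: "h \<in> H \<Longrightarrow> ip (\<lambda>x. 0) h = 0"
  using ip_scale_left[of "\<lambda>x. 0" h 0] zero_mem by simp

lemma ip_add_right:
  assumes "g \<in> H" "h \<in> H" "k \<in> H"
  shows "ip k (\<lambda>x. g x + h x) = ip k g + ip k h"
  using assms ip_commute[of "\<lambda>x. g x + h x" k] ip_add_left[of g h k]
    ip_commute[of g k] ip_commute[of h k] add_mem by simp

lemma ip_scale_right:
  assumes "h \<in> H" "k \<in> H"
  shows "ip k (\<lambda>x. a * h x) = cnj a * ip k h"
  using assms ip_commute[of "\<lambda>x. a * h x" k] ip_scale_left[of h k a]
    ip_commute[of h k] scale_mem by simp

lemma ip_diff_left:
  assumes "g \<in> H" "h \<in> H" "k \<in> H"
  shows "ip (\<lambda>x. g x - h x) k = ip g k - ip h k"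
  using assms ip_add_left[of g "\<lambda>x. (-1) * h x" k] scale_mem[of h "-1"] ip_scale_left[of h k "-1"]
  by simp

lemma ip_self_nonneg:
  assumes "h \<in> H"
  shows "Re (ip h h) \<ge> 0"
  using ip_pos[OF assms] ip_zero_left[OF assms] by (cases "h = (\<lambda>x. 0)") auto

lemma ip_norm_nonneg: "h \<in> H \<Longrightarrow> ip_norm ip h \<ge> 0"
  by (simp add: ip_norm_def ip_self_nonneg)

lemma ip_self:
  assumes "h \<in> H"
  shows "ip h h = of_real ((ip_norm ip h)\<^sup>2)"
proof -
  have "Im (ip h h) = 0"
    using arg_cong[OF ip_commute[OF assms assms], of Im] by simp
  then show ?thesis
    using ip_self_nonneg[OF assms] by (simp add: complex_eq_iff ip_norm_def)
qed

lemma ip_norm_eq_0: "h \<in> H \<Longrightarrow> ip_norm ip h = 0 \<longleftrightarrow> h = (\<lambda>x. 0)"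
  using ip_pos[of h] ip_zero_left[of h] by (cases "h = (\<lambda>x. 0)") (auto simp: ip_norm_def)

text \<open>The common expansion behind scaling, projection, the triangle inequality and the
  parallelogram law; the last two take \<open>a\<close> to be 1 or -1.\<close>

lemma ip_norm_add_sq:
  assumes "g \<in> H" "h \<in> H"
  shows "(ip_norm ip (\<lambda>x. g x + a * h x))\<^sup>2
    = (ip_norm ip g)\<^sup>2 + 2 * Re (cnj a * ip g h) + (cmod a)\<^sup>2 * (ip_norm ip h)\<^sup>2"
proof -
  have m: "(\<lambda>x. a * h x) \<in> H" and s: "(\<lambda>x. g x + a * h x) \<in> H"
    using assms scale_mem add_mem by auto
  have "ip (\<lambda>x. g x + a * h x) (\<lambda>x. g x + a * h x)
      = ip g g + cnj a * ip g h + a * cnj (ip g h) + (a * cnj a) * ip h h"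
    using assms m s by (simp add: ip_add_left ip_add_right ip_scale_left ip_scale_right
        ip_commute[OF assms] algebra_simps)
  moreover have "a * cnj a = of_real ((cmod a)\<^sup>2)"
    by (rule complex_norm_square[symmetric])
  moreover have "cnj a * ip g h + a * cnj (ip g h) = of_real (2 * Re (cnj a * ip g h))"
    by (simp add: complex_eq_iff)
  ultimately have "complex_of_real ((ip_norm ip (\<lambda>x. g x + a * h x))\<^sup>2)
      = of_real ((ip_norm ip g)\<^sup>2 + 2 * Re (cnj a * ip g h) + (cmod a)\<^sup>2 * (ip_norm ip h)\<^sup>2)"
    using ip_self[OF s] ip_self[OF assms(1)] ip_self[OF assms(2)]
    by (simp add: add.assoc)
  then show ?thesis by (simp only: of_real_eq_iff)
qed

lemma ip_norm_scale:
  assumes "h \<in> H"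
  shows "ip_norm ip (\<lambda>x. a * h x) = cmod a * ip_norm ip h"
proof -
  have "(ip_norm ip (\<lambda>x. a * h x))\<^sup>2 = (cmod a * ip_norm ip h)\<^sup>2"
    using ip_norm_add_sq[OF zero_mem assms, of a] ip_zero_left[OF assms] ip_zero_left[OF zero_mem]
    by (simp add: ip_norm_def power_mult_distrib)
  then show ?thesis
    using ip_norm_nonneg[OF assms] ip_norm_nonneg[OF scale_mem[OF assms, of a]]
    by (simp add: power2_eq_iff_nonneg)
qed

text \<open>Adding the multiple of \<open>h\<close> that cancels the projection of \<open>g\<close>
  onto \<open>h\<close> leaves the orthogonal residual, whose length Pythagoras gives. It yields
  both Cauchy-Schwarz and the orthogonality of a nearest point.\<close>

lemma ip_norm_residual:
  assumes "g \<in> H" "h \<in> H" "ip_norm ip h \<noteq> 0"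
  obtains a where "(ip_norm ip (\<lambda>x. g x + a * h x))\<^sup>2
    = (ip_norm ip g)\<^sup>2 - (cmod (ip g h))\<^sup>2 / (ip_norm ip h)\<^sup>2"
proof
  define n where "n = ip_norm ip h"
  define a where "a = - ip g h / of_real (n\<^sup>2)"
  have "cnj a * ip g h = - of_real ((cmod (ip g h))\<^sup>2 / n\<^sup>2)"
    unfolding a_def using complex_norm_square[of "ip g h"] by (simp add: mult.commute)
  then have "Re (cnj a * ip g h) = - (cmod (ip g h))\<^sup>2 / n\<^sup>2"
    by simp
  moreover have "cmod a = cmod (ip g h) / n\<^sup>2"
    by (simp add: a_def norm_divide norm_power)
  then have "(cmod a)\<^sup>2 * n\<^sup>2 = (cmod (ip g h))\<^sup>2 / n\<^sup>2"
    using assms(3) n_def by (simp add: power_divide power2_eq_square)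
  ultimately show "(ip_norm ip (\<lambda>x. g x + a * h x))\<^sup>2
      = (ip_norm ip g)\<^sup>2 - (cmod (ip g h))\<^sup>2 / (ip_norm ip h)\<^sup>2"
    using ip_norm_add_sq[OF assms(1,2), of a] n_def by simp
qed

lemma Cauchy_Schwarz:
  assumes "g \<in> H" "h \<in> H"
  shows "cmod (ip g h) \<le> ip_norm ip g * ip_norm ip h"
proof (cases "ip_norm ip h = 0")
  case True
  then have "h = (\<lambda>x. 0)" using ip_norm_eq_0[OF assms(2)] by blast
  then have "ip g h = 0" using ip_commute[OF assms(2,1)] ip_zero_left[OF assms(1)] by simp
  then show ?thesis using True by simp
next
  case False
  then have n: "ip_norm ip h > 0" using ip_norm_nonneg[OF assms(2)] by simp
  obtain a where "(ip_norm ip (\<lambda>x. g x + a * h x))\<^sup>2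
    = (ip_norm ip g)\<^sup>2 - (cmod (ip g h))\<^sup>2 / (ip_norm ip h)\<^sup>2"
    using ip_norm_residual[OF assms False] .
  then have "0 \<le> (ip_norm ip g)\<^sup>2 - (cmod (ip g h))\<^sup>2 / (ip_norm ip h)\<^sup>2"
    by (metis zero_le_power2)
  then have "(cmod (ip g h))\<^sup>2 \<le> (ip_norm ip g * ip_norm ip h)\<^sup>2"
    using n by (simp add: field_simps power_mult_distrib)
  then show ?thesis
    by (rule power2_le_imp_le) (use n ip_norm_nonneg[OF assms(1)] in simp)
qed

lemma ip_norm_triangle:
  assumes "g \<in> H" "h \<in> H"
  shows "ip_norm ip (\<lambda>x. g x + h x) \<le> ip_norm ip g + ip_norm ip h"
proof (rule power2_le_imp_le)
  have "Re (ip g h) \<le> ip_norm ip g * ip_norm ip h"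
    using Cauchy_Schwarz[OF assms] complex_Re_le_cmod order_trans by blast
  then show "(ip_norm ip (\<lambda>x. g x + h x))\<^sup>2 \<le> (ip_norm ip g + ip_norm ip h)\<^sup>2"
    using ip_norm_add_sq[OF assms, of 1] by (simp add: power2_sum)
qed (use assms ip_norm_nonneg in simp)

lemma ip_norm_diff_commute:
  assumes "g \<in> H" "h \<in> H"
  shows "ip_norm ip (\<lambda>x. g x - h x) = ip_norm ip (\<lambda>x. h x - g x)"
  using ip_norm_scale[OF diff_mem[OF assms], of "-1"] by simp

lemma ip_norm_triangle_diff:
  assumes "g \<in> H" "h \<in> H" "k \<in> H"
  shows "ip_norm ip (\<lambda>x. g x - h x) \<le> ip_norm ip (\<lambda>x. g x - k x) + ip_norm ip (\<lambda>x. k x - h x)"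
  using ip_norm_triangle[OF diff_mem[OF assms(1,3)] diff_mem[OF assms(3,2)]] by simp

lemma ip_norm_diff_le:
  assumes "g \<in> H" "h \<in> H"
  shows "\<bar>ip_norm ip g - ip_norm ip h\<bar> \<le> ip_norm ip (\<lambda>x. g x - h x)"
  using ip_norm_triangle[OF diff_mem[OF assms] assms(2)]
    ip_norm_triangle[OF diff_mem[OF assms(2,1)] assms(1)] ip_norm_diff_commute[OF assms]
  by simp

lemma tendsto_ip_norm:
  assumes "\<And>m. s m \<in> H" "h \<in> H" "(\<lambda>m. ip_norm ip (\<lambda>x. s m x - h x)) \<longlonglongrightarrow> 0"
  shows "(\<lambda>m. ip_norm ip (s m)) \<longlonglongrightarrow> ip_norm ip h"
proof -
  have "(\<lambda>m. ip_norm ip (s m) - ip_norm ip h) \<longlonglongrightarrow> 0"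
    by (rule Lim_null_comparison[OF _ assms(3)])
      (use ip_norm_diff_le assms(1,2) in auto)
  then show ?thesis by (simp add: LIM_zero_iff)
qed

lemma tendsto_ip_left:
  assumes "\<And>m. s m \<in> H" "h \<in> H" "k \<in> H" "(\<lambda>m. ip_norm ip (\<lambda>x. s m x - h x)) \<longlonglongrightarrow> 0"
  shows "(\<lambda>m. ip (s m) k) \<longlonglongrightarrow> ip h k"
proof -
  have "(\<lambda>m. ip_norm ip (\<lambda>x. s m x - h x) * ip_norm ip k) \<longlonglongrightarrow> 0"
    using tendsto_mult_right[OF assms(4), of "ip_norm ip k"] by simp
  then have "(\<lambda>m. ip (s m) k - ip h k) \<longlonglongrightarrow> 0"
    by (rule Lim_null_comparison[rotated])
      (use assms(1-3) Cauchy_Schwarz[OF diff_mem[of "s _" h]] ip_diff_left in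
        \<open>auto intro!: always_eventually\<close>)
  then show ?thesis by (simp add: LIM_zero_iff)
qed

lemma tendsto_ip_right:
  assumes "\<And>m. s m \<in> H" "h \<in> H" "k \<in> H" "(\<lambda>m. ip_norm ip (\<lambda>x. s m x - h x)) \<longlonglongrightarrow> 0"
  shows "(\<lambda>m. ip k (s m)) \<longlonglongrightarrow> ip k h"
  using tendsto_cnj[OF tendsto_ip_left[OF assms]] ip_commute[OF _ assms(3)] assms(1,2) by simp

lemma parallelogram:
  assumes "g \<in> H" "h \<in> H"
  shows "(ip_norm ip (\<lambda>x. g x + h x))\<^sup>2 + (ip_norm ip (\<lambda>x. g x - h x))\<^sup>2
    = 2 * (ip_norm ip g)\<^sup>2 + 2 * (ip_norm ip h)\<^sup>2"
  using ip_norm_add_sq[OF assms, of 1] ip_norm_add_sq[OF assms, of "-1"] by simp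

text \<open>Completeness in the form in which the estimates arise: each index contributes its own
  error term tending to zero.\<close>

lemma ip_convergentI:
  assumes "\<And>m. s m \<in> H"
    and "\<And>i j. ip_norm ip (\<lambda>x. s i x - s j x) \<le> b i + b j" and "b \<longlonglongrightarrow> 0"
  obtains h where "h \<in> H" "(\<lambda>m. ip_norm ip (\<lambda>x. s m x - h x)) \<longlonglongrightarrow> 0"
proof -
  have "\<exists>N. \<forall>i\<ge>N. \<forall>j\<ge>N. ip_norm ip (\<lambda>x. s i x - s j x) < e" if "e > 0" for e
  proof -
    have "e / 2 > 0" using that by simp
    then obtain N where N: "\<And>i. i \<ge> N \<Longrightarrow> norm (b i) < e / 2"
      using LIMSEQ_D[OF assms(3)] by fastforce
    have "ip_norm ip (\<lambda>x. s i x - s j x) < e" if "i \<ge> N" "j \<ge> N" for i j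
      using assms(2)[of i j] N[OF that(1)] N[OF that(2)] by simp
    then show ?thesis by blast
  qed
  then show ?thesis using complete[of s] assms(1) that by blast
qed

end

subsection \<open>Density of the span of the kernels\<close>

text \<open>Finite combinations are built one kernel at a time, so that facts about the span follow
  by induction from facts about a single kernel.\<close>

inductive_set (in reproducing_kernel_hilbert_space) kernel_span :: "('a \<Rightarrow> complex) set" where
  zero: "(\<lambda>x. 0) \<in> kernel_span"
| add_kernel: "z \<in> X \<Longrightarrow> h \<in> kernel_span \<Longrightarrow> (\<lambda>x. a * K z x + h x) \<in> kernel_span"

context reproducing_kernel_hilbert_space
begin

lemma kernel_span_mem: "h \<in> kernel_span \<Longrightarrow> h \<in> H"
  by (induction rule: kernel_span.induct)
    (simp_all only: zero_mem add_mem[OF scale_mem[OF kernel_mem]])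

lemma kernel_span_scale: "h \<in> kernel_span \<Longrightarrow> (\<lambda>x. a * h x) \<in> kernel_span"
proof (induction rule: kernel_span.induct)
  case zero
  then show ?case using kernel_span.zero by simp
next
  case (add_kernel z h b)
  then show ?case using kernel_span.add_kernel[of z "\<lambda>x. a * h x" "a * b"]
    by (simp add: algebra_simps)
qed

lemma kernel_span_add: "g \<in> kernel_span \<Longrightarrow> h \<in> kernel_span \<Longrightarrow> (\<lambda>x. g x + h x) \<in> kernel_span"
proof (induction rule: kernel_span.induct)
  case zero
  then show ?case by simp
next
  case (add_kernel z g a)
  then show ?case using kernel_span.add_kernel[of z "\<lambda>x. g x + h x" a]
    by (simp add: add.assoc)
qed

lemma kernel_commute: "z \<in> X \<Longrightarrow> w \<in> X \<Longrightarrow> cnj (K z w) = K w z"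
  using reproducing[OF _ kernel_mem] ip_commute[OF kernel_mem kernel_mem] by metis

text \<open>Evaluation at a point of \<open>X\<close> is the inner product with a kernel, hence
  continuous in norm; off \<open>X\<close> every function is zero. This identifies norm limits
  pointwise.\<close>

lemma tendsto_eval:
  assumes "\<And>m. s m \<in> H" "h \<in> H" "(\<lambda>m. ip_norm ip (\<lambda>x. s m x - h x)) \<longlonglongrightarrow> 0"
  shows "(\<lambda>m. s m x) \<longlonglongrightarrow> h x"
proof (cases "x \<in> X")
  case True
  then show ?thesis
    using tendsto_ip_left[OF assms(1,2) kernel_mem assms(3)] reproducing[OF _ assms(1)] reproducing[OF _ assms(2)]
    by simp
next
  case False
  then show ?thesis using vanishes_outside[OF assms(1)] vanishes_outside[OF assms(2)] by simp
qed

text \<open>If \<open>q z\<close> were nonzero, removing the projection of \<open>q\<close> onto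
  \<open>K z\<close> would strictly shorten \<open>q\<close>.\<close>

lemma orthogonal_if_nearest:
  assumes q: "q \<in> H" and z: "z \<in> X"
    and min: "\<And>a. (ip_norm ip q)\<^sup>2 \<le> (ip_norm ip (\<lambda>x. q x + a * K z x))\<^sup>2"
  shows "q z = 0"
proof (rule ccontr)
  assume nz: "q z \<noteq> 0"
  have eval: "ip q (K z) = q z" using reproducing[OF z q] .
  then have "ip_norm ip (K z) \<noteq> 0"
    using nz Cauchy_Schwarz[OF q kernel_mem[OF z]] by auto
  moreover from this obtain a where "(ip_norm ip (\<lambda>x. q x + a * K z x))\<^sup>2
      = (ip_norm ip q)\<^sup>2 - (cmod (ip q (K z)))\<^sup>2 / (ip_norm ip (K z))\<^sup>2"
    using ip_norm_residual[OF q kernel_mem[OF z]] by blast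
  ultimately have "(cmod (q z))\<^sup>2 / (ip_norm ip (K z))\<^sup>2 \<le> 0"
    using min[of a] eval by simp
  then show False using nz \<open>ip_norm ip (K z) \<noteq> 0\<close> by (simp add: divide_le_0_iff)
qed

text \<open>A minimising sequence for the distance from \<open>h\<close> to the span is Cauchy by the parallelogram law;
  the difference of \<open>h\<close> and its limit is orthogonal to all kernels, hence zero.\<close>

lemma kernel_span_dense:
  assumes h: "h \<in> H"
  obtains s where "\<And>m. s m \<in> kernel_span" "(\<lambda>m. ip_norm ip (\<lambda>x. s m x - h x)) \<longlonglongrightarrow> 0"
proof -
  define D where "D = (\<lambda>s. (ip_norm ip (\<lambda>x. h x - s x))\<^sup>2) ` kernel_span"
  define d where "d = Inf D"
  have bdd: "bdd_below D" unfolding D_def by (intro bdd_belowI[of _ 0]) auto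
  have ne: "D \<noteq> {}" unfolding D_def using kernel_span.zero by auto
  have d_le: "d \<le> (ip_norm ip (\<lambda>x. h x - s x))\<^sup>2" if "s \<in> kernel_span" for s
    unfolding d_def using bdd that by (intro cInf_lower) (auto simp: D_def)
  have "\<exists>s\<in>kernel_span. (ip_norm ip (\<lambda>x. h x - s x))\<^sup>2 < d + (inverse (Suc m))\<^sup>2" for m
  proof -
    have "Inf D < d + (inverse (Suc m))\<^sup>2" unfolding d_def by simp
    from cInf_lessD[OF ne this] show ?thesis unfolding D_def by auto
  qed
  then obtain s where s: "\<And>m. s m \<in> kernel_span"
    and s_d: "\<And>m. (ip_norm ip (\<lambda>x. h x - s m x))\<^sup>2 < d + (inverse (Suc m))\<^sup>2"
    by metis
  have sH: "s m \<in> H" for m using s kernel_span_mem by blast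
  have cauchy: "ip_norm ip (\<lambda>x. s i x - s j x) \<le> 2 * inverse (Suc i) + 2 * inverse (Suc j)" for i j
  proof (rule power2_le_imp_le)
    \<comment> \<open>The midpoint lies in the span, so its squared distance from \<open>h\<close>
      is at least \<open>d\<close>. In the parallelogram law the four copies of \<open>d\<close>
      cancel and only the excesses of \<open>s i\<close> and \<open>s j\<close> over
      \<open>d\<close> remain.\<close>
    define mid where "mid = (\<lambda>x. 1/2 * (s i x + s j x))"
    have mid: "mid \<in> kernel_span"
      unfolding mid_def by (rule kernel_span_scale[OF kernel_span_add[OF s s]])
    have "(\<lambda>x. (h x - s i x) + (h x - s j x)) = (\<lambda>x. 2 * (h x - mid x))"
      by (simp add: mid_def fun_eq_iff field_simps)
    then have "(ip_norm ip (\<lambda>x. (h x - s i x) + (h x - s j x)))\<^sup>2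
        = 4 * (ip_norm ip (\<lambda>x. h x - mid x))\<^sup>2"
      using ip_norm_scale[OF diff_mem[OF h kernel_span_mem[OF mid]], of 2]
      by (simp add: power_mult_distrib)
    moreover have "d \<le> (ip_norm ip (\<lambda>x. h x - mid x))\<^sup>2" using d_le[OF mid] .
    moreover have "(\<lambda>x. (h x - s i x) - (h x - s j x)) = (\<lambda>x. s j x - s i x)" by auto
    ultimately have "(ip_norm ip (\<lambda>x. s j x - s i x))\<^sup>2
        \<le> 2 * (inverse (Suc i))\<^sup>2 + 2 * (inverse (Suc j))\<^sup>2"
      using parallelogram[OF diff_mem[OF h sH[of i]] diff_mem[OF h sH[of j]]] s_d[of i] s_d[of j]
      by simp
    also have "\<dots> \<le> (2 * inverse (Suc i) + 2 * inverse (Suc j))\<^sup>2"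
      by (simp add: power2_sum power_mult_distrib)
    finally show "(ip_norm ip (\<lambda>x. s i x - s j x))\<^sup>2 \<le> (2 * inverse (Suc i) + 2 * inverse (Suc j))\<^sup>2"
      using ip_norm_diff_commute[OF sH[of i] sH[of j]] by simp
  qed auto
  have lim0: "(\<lambda>m. 2 * inverse (real (Suc m))) \<longlonglongrightarrow> 0"
    using tendsto_mult_left[OF LIMSEQ_inverse_real_of_nat, of 2] by simp
  obtain p where p: "p \<in> H" and lim: "(\<lambda>m. ip_norm ip (\<lambda>x. s m x - p x)) \<longlonglongrightarrow> 0"
    using ip_convergentI[OF sH cauchy lim0] by blast
  define q where "q = (\<lambda>x. h x - p x)"
  have q: "q \<in> H" unfolding q_def using h p by (rule diff_mem)
  \<comment> \<open>The shift \<open>g\<close> lets one limit serve twice: \<open>g = 0\<close>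
    bounds the norm of \<open>q\<close> above, and a multiple of a kernel bounds the norm of the
    shifted \<open>q\<close> below.\<close>
  have lim_shift: "(\<lambda>m. (ip_norm ip (\<lambda>x. (h x - s m x) + g x))\<^sup>2)
      \<longlonglongrightarrow> (ip_norm ip (\<lambda>x. q x + g x))\<^sup>2" if g: "g \<in> H" for g
  proof (intro tendsto_power tendsto_ip_norm)
    have "(\<lambda>x. (h x - s m x + g x) - (q x + g x)) = (\<lambda>x. p x - s m x)" for m
      by (auto simp: q_def)
    then show "(\<lambda>m. ip_norm ip (\<lambda>x. (h x - s m x + g x) - (q x + g x))) \<longlonglongrightarrow> 0"
      using lim ip_norm_diff_commute[OF p sH] by simp
  qed (use h sH q g add_mem diff_mem in auto)
  have "(ip_norm ip q)\<^sup>2 \<le> d"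
  proof (rule LIMSEQ_le)
    show "(\<lambda>m. (ip_norm ip (\<lambda>x. h x - s m x))\<^sup>2) \<longlonglongrightarrow> (ip_norm ip q)\<^sup>2"
      using lim_shift[OF zero_mem] by simp
    show "(\<lambda>m. d + (inverse (real (Suc m)))\<^sup>2) \<longlonglongrightarrow> d"
      using tendsto_add[OF tendsto_const tendsto_power[OF LIMSEQ_inverse_real_of_nat, of 2], of d]
      by simp
  qed (use s_d less_imp_le in blast)
  moreover have "d \<le> (ip_norm ip (\<lambda>x. q x + a * K z x))\<^sup>2" if "z \<in> X" for a z
  proof (rule LIMSEQ_le_const[OF lim_shift[OF scale_mem[OF kernel_mem[OF that]]]])
    have "d \<le> (ip_norm ip (\<lambda>x. h x - s m x + a * K z x))\<^sup>2" for m
      using d_le[OF kernel_span.add_kernel[OF that s, of "- a" m]] by (simp add: algebra_simps)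
    then show "\<exists>N. \<forall>m\<ge>N. d \<le> (ip_norm ip (\<lambda>x. h x - s m x + a * K z x))\<^sup>2" by blast
  qed
  ultimately have "q z = 0" if "z \<in> X" for z
    using orthogonal_if_nearest[OF q that] that order_trans by blast
  \<comment> \<open>\<open>q\<close> is zero on \<open>X\<close> by orthogonality to the kernels,
    and outside \<open>X\<close> because \<open>h\<close> and \<open>p\<close> both vanish
    there.\<close>
  then have "p = h"
    using vanishes_outside h p by (auto simp: q_def fun_eq_iff) (metis)
  then show ?thesis using that[OF s] lim by simp
qed

end

subsection \<open>Boundedness of symmetric weighted compositions\<close>

text \<open>Boundedness is not assumed here. It is replaced by a bound on the weight and by growth
  of kernel norms along orbits, where the factor may depend on the starting point but the rate
  \<open>R\<close> may not.\<close>

locale symmetric_weighted_composition = reproducing_kernel_hilbert_space X H ip K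
  for X :: "'a set"
    and H :: "('a \<Rightarrow> complex) set"
    and ip :: "('a \<Rightarrow> complex) \<Rightarrow> ('a \<Rightarrow> complex) \<Rightarrow> complex"
    and K :: "'a \<Rightarrow> 'a \<Rightarrow> complex" +
  fixes f :: "'a \<Rightarrow> complex" and \<phi> :: "'a \<Rightarrow> 'a" and B R :: real
  assumes self_map: "z \<in> X \<Longrightarrow> \<phi> z \<in> X"
    and kernel_symmetry: "z \<in> X \<Longrightarrow> w \<in> X \<Longrightarrow> f w * K z (\<phi> w) = cnj (f z) * K (\<phi> z) w"
    and weight_bound: "z \<in> X \<Longrightarrow> cmod (f z) \<le> B"
    and bound_pos: "B > 0" "R > 0"
    and orbit_growth: "z \<in> X \<Longrightarrow> \<exists>C. \<forall>m. ip_norm ip (K ((\<phi> ^^ m) z)) \<le> C * R ^ m"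
begin

definition W :: "('a \<Rightarrow> complex) \<Rightarrow> 'a \<Rightarrow> complex" where
  "W h = (\<lambda>x. if x \<in> X then f x * h (\<phi> x) else 0)"

lemma W_kernel:
  assumes "z \<in> X"
  shows "W (K z) = (\<lambda>x. cnj (f z) * K (\<phi> z) x)"
  using assms kernel_symmetry vanishes_outside[OF kernel_mem[OF self_map]]
  by (auto simp: W_def fun_eq_iff)

lemma W_linear: "W (\<lambda>x. a * g x + h x) = (\<lambda>x. a * W g x + W h x)"
  by (auto simp: W_def algebra_simps)

lemma W_zero: "W (\<lambda>x. 0) = (\<lambda>x. 0)"
  by (auto simp: W_def)

lemma W_kernel_span: "h \<in> kernel_span \<Longrightarrow> W h \<in> kernel_span"
proof (induction rule: kernel_span.induct)
  case zero
  then show ?case using kernel_span.zero by (simp add: W_zero)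
next
  case (add_kernel z h a)
  then show ?case
    using kernel_span.add_kernel[OF self_map[of z] add_kernel.IH, of "a * cnj (f z)"]
    by (simp add: W_linear W_kernel mult.assoc)
qed

lemma W_pow_kernel_span: "h \<in> kernel_span \<Longrightarrow> (W ^^ m) h \<in> kernel_span"
  by (induction m) (auto intro: W_kernel_span)

lemma W_pow_linear: "(W ^^ m) (\<lambda>x. a * g x + h x) = (\<lambda>x. a * (W ^^ m) g x + (W ^^ m) h x)"
  by (induction m) (simp_all add: W_linear)

lemma W_pow_zero: "(W ^^ m) (\<lambda>x. 0) = (\<lambda>x. 0)"
  by (induction m) (simp_all add: W_zero)

lemma orbit_mem: "z \<in> X \<Longrightarrow> (\<phi> ^^ m) z \<in> X"
  by (induction m) (auto intro: self_map)

text \<open>Each application of \<open>W\<close> moves the base point one step along its orbit and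
  contributes one conjugated weight of modulus at most \<open>B\<close>.\<close>

lemma W_pow_kernel:
  assumes z: "z \<in> X"
  shows "\<exists>a. (W ^^ m) (K z) = (\<lambda>x. a * K ((\<phi> ^^ m) z) x) \<and> cmod a \<le> B ^ m"
proof (induction m)
  case 0
  show ?case by (rule exI[of _ 1]) simp
next
  case (Suc m)
  then obtain a where a: "(W ^^ m) (K z) = (\<lambda>x. a * K ((\<phi> ^^ m) z) x)" "cmod a \<le> B ^ m"
    by blast
  let ?w = "(\<phi> ^^ m) z"
  have "(W ^^ Suc m) (K z) = (\<lambda>x. (a * cnj (f ?w)) * K ((\<phi> ^^ Suc m) z) x)"
    using W_linear[of a "K ?w" "\<lambda>x. 0"] W_kernel[OF orbit_mem[OF z]] a(1)
    by (simp add: W_zero mult.assoc)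
  moreover have "cmod (a * cnj (f ?w)) \<le> B ^ Suc m"
    using mult_mono[OF a(2) weight_bound[OF orbit_mem[OF z, of m]]] bound_pos
    by (simp add: norm_mult mult.commute)
  ultimately show ?case by blast
qed

text \<open>Only the factor \<open>C\<close> depends on \<open>h\<close>; the uniform rate
  \<open>B * R\<close> is what survives as the operator bound. The factors add up over the kernels
  that make up \<open>h\<close>.\<close>

lemma W_pow_growth:
  "h \<in> kernel_span \<Longrightarrow> \<exists>C. \<forall>m. ip_norm ip ((W ^^ m) h) \<le> C * (B * R) ^ m"
proof (induction rule: kernel_span.induct)
  case zero
  have "ip_norm ip (\<lambda>x. 0) = 0" using ip_norm_eq_0 zero_mem by simp
  then show ?case by (intro exI[of _ 0]) (simp add: W_pow_zero)
next
  case (add_kernel z h a)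
  obtain C where C: "\<And>m. ip_norm ip ((W ^^ m) h) \<le> C * (B * R) ^ m"
    using add_kernel.IH by blast
  obtain C' where C': "\<And>m. ip_norm ip (K ((\<phi> ^^ m) z)) \<le> C' * R ^ m"
    using orbit_growth[OF add_kernel.hyps(1)] by blast
  have "ip_norm ip ((W ^^ m) (\<lambda>x. a * K z x + h x)) \<le> (cmod a * C' + C) * (B * R) ^ m" for m
  proof -
    let ?w = "(\<phi> ^^ m) z"
    have w: "K ?w \<in> H" using orbit_mem add_kernel.hyps kernel_mem by blast
    have g: "(W ^^ m) h \<in> H"
      using add_kernel.hyps W_pow_kernel_span kernel_span_mem by blast
    obtain b where b: "(W ^^ m) (K z) = (\<lambda>x. b * K ?w x)" "cmod b \<le> B ^ m"
      using W_pow_kernel[OF add_kernel.hyps(1)] by blast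
    have "(W ^^ m) (\<lambda>x. a * K z x + h x) = (\<lambda>x. (a * b) * K ?w x + (W ^^ m) h x)"
      using W_pow_linear b(1) by (simp add: mult.assoc)
    then have "ip_norm ip ((W ^^ m) (\<lambda>x. a * K z x + h x))
        \<le> cmod (a * b) * ip_norm ip (K ?w) + ip_norm ip ((W ^^ m) h)"
      using ip_norm_triangle[OF scale_mem[OF w] g, of "a * b"] ip_norm_scale[OF w, of "a * b"] by simp
    also have "cmod (a * b) * ip_norm ip (K ?w) \<le> (cmod a * B ^ m) * (C' * R ^ m)"
      using b(2) C'[of m] ip_norm_nonneg[OF w] bound_pos
      by (intro mult_mono) (auto simp: norm_mult intro: mult_left_mono)
    finally show ?thesis using C[of m] by (simp add: algebra_simps power_mult_distrib)
  qed
  then show ?case by blast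
qed

text \<open>Both sides reduce to the value \<open>f z * h (\<phi> z)\<close> on each kernel.
  Membership of \<open>W h\<close> is a hypothesis because it is known at this stage only on the
  span; \<open>h\<close> itself stays arbitrary for the later use on all of
  \<open>H\<close>.\<close>

lemma W_symmetric_left:
  assumes "h \<in> H" "W h \<in> H"
  shows "k \<in> kernel_span \<Longrightarrow> ip (W h) k = ip h (W k)"
proof (induction rule: kernel_span.induct)
  case zero
  then show ?case
    using ip_commute[OF zero_mem assms(1)] ip_commute[OF zero_mem assms(2)] ip_zero_left assms
    by (simp add: W_zero)
next
  case (add_kernel z k a)
  have kern: "K z \<in> H" "K (\<phi> z) \<in> H" "k \<in> H" "W k \<in> H"
    using add_kernel.hyps kernel_mem self_map kernel_span_mem W_kernel_span by auto
  have "ip (W h) (\<lambda>x. a * K z x + k x) = cnj a * ip (W h) (K z) + ip (W h) k"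
    using kern assms by (simp add: ip_add_right ip_scale_right scale_mem)
  also have "ip (W h) (K z) = f z * h (\<phi> z)"
    using reproducing[OF add_kernel.hyps(1) assms(2)] add_kernel.hyps(1) by (simp add: W_def)
  also have "\<dots> = f z * ip h (K (\<phi> z))"
    using reproducing[OF self_map[OF add_kernel.hyps(1)] assms(1)] by simp
  finally have "ip (W h) (\<lambda>x. a * K z x + k x)
      = cnj (a * cnj (f z)) * ip h (K (\<phi> z)) + ip h (W k)"
    using add_kernel.IH by (simp add: mult.assoc)
  also have "\<dots> = ip h (\<lambda>x. (a * cnj (f z)) * K (\<phi> z) x + W k x)"
    using kern assms by (simp add: ip_add_right ip_scale_right scale_mem)
  also have "(\<lambda>x. (a * cnj (f z)) * K (\<phi> z) x + W k x) = W (\<lambda>x. a * K z x + k x)"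
    using W_linear W_kernel[OF add_kernel.hyps(1)] by (simp add: mult.assoc)
  finally show ?case .
qed

lemma W_pow_symmetric:
  assumes "h \<in> kernel_span" "k \<in> kernel_span"
  shows "ip ((W ^^ m) h) k = ip h ((W ^^ m) k)"
  using assms
proof (induction m arbitrary: k)
  case (Suc m)
  have "ip (W ((W ^^ m) h)) k = ip ((W ^^ m) h) (W k)"
    using Suc.prems W_pow_kernel_span W_kernel_span kernel_span_mem
    by (intro W_symmetric_left) blast+
  also have "\<dots> = ip h ((W ^^ m) (W k))"
    using Suc W_kernel_span by blast
  finally show ?case by (simp add: funpow_swap1)
qed simp

text \<open>Symmetry moves one factor across: the squared norm is the inner product of the
  \<open>2 * m\<close>-th iterate with \<open>h\<close>, to which Cauchy-Schwarz applies.\<close>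

lemma W_pow_square_le:
  assumes "h \<in> kernel_span"
  shows "(ip_norm ip ((W ^^ m) h))\<^sup>2 \<le> ip_norm ip ((W ^^ (2 * m)) h) * ip_norm ip h"
proof -
  have mem: "(W ^^ m) h \<in> H" for m
    using assms W_pow_kernel_span kernel_span_mem by blast
  have "complex_of_real ((ip_norm ip ((W ^^ m) h))\<^sup>2) = ip ((W ^^ m) ((W ^^ m) h)) h"
    using ip_self[OF mem] W_pow_symmetric[OF W_pow_kernel_span[OF assms] assms] by metis
  also have "(W ^^ m) ((W ^^ m) h) = (W ^^ (2 * m)) h"
    by (simp add: mult_2 funpow_add)
  finally have "(ip_norm ip ((W ^^ m) h))\<^sup>2 = cmod (ip ((W ^^ (2 * m)) h) h)"
    by (metis norm_of_real abs_power2)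
  then show ?thesis using Cauchy_Schwarz[OF mem kernel_span_mem[OF assms]] by simp
qed

text \<open>Iterating \<^prop>\<open>(ip_norm ip (W h))\<^sup>2 \<le> ip_norm ip (W (W h)) * ip_norm ip h\<close> compares
  \<^term>\<open>ip_norm ip (W h) ^ (2 ^ k)\<close> with the norm of the \<open>2\<^sup>k\<close>-th iterate, whose growth
  rate does not depend on \<open>h\<close>.\<close>

lemma W_bound_kernel_span:
  assumes "h \<in> kernel_span"
  shows "ip_norm ip (W h) \<le> B * R * ip_norm ip h"
proof (cases "ip_norm ip h = 0")
  case True
  \<comment> \<open>The case \<open>m = 1\<close> has the factor \<open>ip_norm ip h = 0\<close> on
    its right-hand side.\<close>
  then have "(ip_norm ip (W h))\<^sup>2 \<le> 0" using W_pow_square_le[OF assms, of 1] by simp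
  then show ?thesis using True by simp
next
  case False
  define n where "n m = ip_norm ip ((W ^^ m) h)" for m
  have n_nonneg: "n m \<ge> 0" for m
    unfolding n_def using assms W_pow_kernel_span kernel_span_mem ip_norm_nonneg by blast
  have n0: "n 0 > 0" using False n_nonneg[of 0] by (simp add: n_def)
  have doubling: "(n m)\<^sup>2 \<le> n (2 * m) * n 0" for m
    unfolding n_def using W_pow_square_le[OF assms] by simp
  \<comment> \<open>Dividing by \<open>n 0\<close> turns \<open>doubling\<close> into pure squaring,
    which can be iterated.\<close>
  have iter: "(n 1 / n 0) ^ (2 ^ k) \<le> n (2 ^ k) / n 0" for k
  proof (induction k)
    case (Suc k)
    have "(n 1 / n 0) ^ (2 ^ Suc k) = ((n 1 / n 0) ^ (2 ^ k))\<^sup>2"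
      by (simp add: power_mult[symmetric] mult.commute)
    also have "\<dots> \<le> (n (2 ^ k) / n 0)\<^sup>2"
      using Suc n_nonneg[of 1] n0 by (intro power_mono) auto
    also have "\<dots> \<le> n (2 ^ Suc k) / n 0"
      using doubling[of "2 ^ k"] n0 by (simp add: field_simps power2_eq_square)
    finally show ?case .
  qed simp
  obtain C where C: "\<And>m. n m \<le> C * (B * R) ^ m"
    using W_pow_growth[OF assms] n_def by metis
  \<comment> \<open>\<open>t\<close> compares the actual stretching of \<open>h\<close> with the
    claimed bound; its powers with exponents \<open>2 ^ k\<close> stay bounded, which excludes
    \<open>t > 1\<close>.\<close>
  define t where "t = n 1 / n 0 / (B * R)"
  have t_le: "t ^ (2 ^ k) \<le> C / n 0" for k
  proof -
    have "(n 1 / n 0) ^ (2 ^ k) \<le> C * (B * R) ^ (2 ^ k) / n 0"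
      using iter[of k] C[of "2 ^ k"] n0 by (meson divide_right_mono order_trans less_imp_le)
    then have "(n 1 / n 0) ^ (2 ^ k) / (B * R) ^ (2 ^ k) \<le> C / n 0"
      using bound_pos n0 by (simp add: field_simps)
    then show ?thesis unfolding t_def by (simp only: power_divide)
  qed
  have "t \<le> 1"
  proof (rule ccontr)
    assume "\<not> t \<le> 1"
    then have t: "t > 1" by simp
    obtain k where "C / n 0 < t ^ k" using real_arch_pow[OF t] by blast
    also have "t ^ k \<le> t ^ (2 ^ k)" using t by (intro power_increasing) (auto intro: less_imp_le)
    finally show False using t_le[of k] by simp
  qed
  then show ?thesis unfolding t_def n_def using n0 bound_pos
    by (simp add: n_def divide_le_eq mult_ac split: if_splits)
qed

section \<open>Extension from the span to the whole space\<close>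

text \<open>The images of an approximating sequence from the span converge in norm. Their limit is
  \<open>W h\<close> because evaluation is continuous and \<open>W\<close> acts pointwise.\<close>

lemma W_mem_and_bound:
  assumes h: "h \<in> H"
  shows "W h \<in> H \<and> ip_norm ip (W h) \<le> B * R * ip_norm ip h"
proof -
  obtain s where s: "\<And>m. s m \<in> kernel_span"
    and lim: "(\<lambda>m. ip_norm ip (\<lambda>x. s m x - h x)) \<longlonglongrightarrow> 0"
    using kernel_span_dense[OF h] by blast
  have sH: "s m \<in> H" and WsH: "W (s m) \<in> H" for m
    using s W_kernel_span kernel_span_mem by blast+
  define b where "b m = B * R * ip_norm ip (\<lambda>x. s m x - h x)" for m
  have b: "b \<longlonglongrightarrow> 0" unfolding b_def using tendsto_mult_left[OF lim, of "B * R"] by simp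
  have "ip_norm ip (\<lambda>x. W (s i) x - W (s j) x) \<le> b i + b j" for i j
  proof -
    \<comment> \<open>The difference is written in the shape \<open>a * g x + h x\<close> to which
      \<open>W_linear\<close> applies.\<close>
    have diff: "(\<lambda>x. (-1) * s j x + s i x) \<in> kernel_span"
      using s kernel_span_add kernel_span_scale by blast
    have "ip_norm ip (W (\<lambda>x. (-1) * s j x + s i x)) \<le> B * R * ip_norm ip (\<lambda>x. (-1) * s j x + s i x)"
      using W_bound_kernel_span[OF diff] .
    then have "ip_norm ip (\<lambda>x. W (s i) x - W (s j) x) \<le> B * R * ip_norm ip (\<lambda>x. s i x - s j x)"
      unfolding W_linear by simp
    also have "\<dots> \<le> B * R * (ip_norm ip (\<lambda>x. s i x - h x) + ip_norm ip (\<lambda>x. h x - s j x))"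
      using ip_norm_triangle_diff[OF sH sH h] bound_pos by (intro mult_left_mono) auto
    finally show ?thesis
      using ip_norm_diff_commute[OF h sH] by (simp add: b_def algebra_simps)
  qed
  then obtain g where g: "g \<in> H" and glim: "(\<lambda>m. ip_norm ip (\<lambda>x. W (s m) x - g x)) \<longlonglongrightarrow> 0"
    using ip_convergentI[of "\<lambda>m. W (s m)" b] WsH b by blast
  have "W h = g"
  proof
    fix x
    have "(\<lambda>m. W (s m) x) \<longlonglongrightarrow> W h x"
      unfolding W_def using tendsto_mult_left[OF tendsto_eval[OF sH h lim]] by simp
    then show "W h x = g x"
      using tendsto_eval[OF WsH g glim] LIMSEQ_unique by blast
  qed
  moreover have "ip_norm ip g \<le> B * R * ip_norm ip h"
  proof (rule LIMSEQ_le)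
    show "(\<lambda>m. ip_norm ip (W (s m))) \<longlonglongrightarrow> ip_norm ip g"
      using tendsto_ip_norm[OF WsH g glim] .
    show "(\<lambda>m. B * R * ip_norm ip (s m)) \<longlonglongrightarrow> B * R * ip_norm ip h"
      by (intro tendsto_mult_left tendsto_ip_norm[OF sH h lim])
  qed (use W_bound_kernel_span[OF s] in blast)
  ultimately show ?thesis using g by simp
qed

lemma bounded_W: "bounded_operator_on H ip W"
  unfolding bounded_operator_on_def
proof (intro conjI ballI allI)
  show "W (\<lambda>x. g x + h x) = (\<lambda>x. W g x + W h x)" for g h
    using W_linear[of 1 g h] by simp
  show "W (\<lambda>x. a * h x) = (\<lambda>x. a * W h x)" for a h
    using W_linear[of a h "\<lambda>x. 0"] by (simp add: W_zero)
qed (use W_mem_and_bound in blast)+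

lemma self_adjoint_W: "self_adjoint_operator_on H ip W"
  unfolding self_adjoint_operator_on_def
proof (intro ballI)
  fix h k assume h: "h \<in> H" and k: "k \<in> H"
  \<comment> \<open>Only \<open>k\<close> needs approximation, since \<open>W_symmetric_left\<close>
    already allows every \<open>h\<close> with image in \<open>H\<close>.\<close>
  obtain s where s: "\<And>m. s m \<in> kernel_span"
    and lim: "(\<lambda>m. ip_norm ip (\<lambda>x. s m x - k x)) \<longlonglongrightarrow> 0"
    using kernel_span_dense[OF k] by blast
  have sH: "s m \<in> H" for m using s kernel_span_mem by blast
  have W: "g \<in> H \<Longrightarrow> W g \<in> H" for g using W_mem_and_bound by blast
  have Wlim: "(\<lambda>m. ip_norm ip (\<lambda>x. W (s m) x - W k x)) \<longlonglongrightarrow> 0"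
  proof (rule Lim_null_comparison)
    have "W (\<lambda>x. s m x - k x) = (\<lambda>x. W (s m) x - W k x)" for m
      using W_linear[of "-1" k "s m"] by simp
    then show "\<forall>\<^sub>F m in sequentially. norm (ip_norm ip (\<lambda>x. W (s m) x - W k x))
        \<le> B * R * ip_norm ip (\<lambda>x. s m x - k x)"
      using W_mem_and_bound[OF diff_mem[OF sH k]] ip_norm_nonneg[OF diff_mem[OF W[OF sH] W[OF k]]]
      by (intro always_eventually) simp
    show "(\<lambda>m. B * R * ip_norm ip (\<lambda>x. s m x - k x)) \<longlonglongrightarrow> 0"
      using tendsto_mult_left[OF lim, of "B * R"] by simp
  qed
  have "(\<lambda>m. ip (W h) (s m)) \<longlonglongrightarrow> ip (W h) k"
    using tendsto_ip_right[OF sH k W[OF h] lim] .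
  moreover have "(\<lambda>m. ip (W h) (s m)) \<longlonglongrightarrow> ip h (W k)"
    using tendsto_ip_right[OF W[OF sH] W[OF k] h Wlim] W_symmetric_left[OF h W[OF h] s] by simp
  ultimately show "ip (W h) k = ip h (W k)" using LIMSEQ_unique by blast
qed

end

subsection \<open>The Hermitian form and the kernels on the ball\<close>

lemma cinner_add_left: "cinner (x + y) z = cinner x z + cinner y z"
  by (simp add: cinner_def algebra_simps sum.distrib)

lemma cinner_diff_left: "cinner (x - y) z = cinner x z - cinner y z"
  by (simp add: cinner_def algebra_simps sum_subtractf)

lemma cinner_scale_left: "cinner (a *s x) z = a * cinner x z"
  by (simp add: cinner_def sum_distrib_left mult.assoc)

lemma cnj_cinner: "cnj (cinner z w) = cinner w z"
  by (simp add: cinner_def mult.commute)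

lemma cinner_add_right: "cinner z (x + y) = cinner z x + cinner z y"
  by (simp add: cinner_def algebra_simps sum.distrib)

lemma cinner_diff_right: "cinner z (x - y) = cinner z x - cinner z y"
  by (simp add: cinner_def algebra_simps sum_subtractf)

lemma cinner_scale_right: "cinner z (a *s x) = cnj a * cinner z x"
  by (simp add: cinner_def sum_distrib_left algebra_simps)

lemma cinner_zero_left [simp]: "cinner 0 z = 0"
  by (simp add: cinner_def)

lemma cinner_zero_right [simp]: "cinner z 0 = 0"
  by (simp add: cinner_def)

lemma cinner_self: "cinner z z = of_real ((norm z)\<^sup>2)"
proof -
  have "(norm z)\<^sup>2 = (\<Sum>j\<in>UNIV. (cmod (z $ j))\<^sup>2)"
    by (simp add: norm_vec_def L2_set_def sum_nonneg)
  then show ?thesis by (simp add: cinner_def flip: complex_norm_square)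
qed

lemma norm_cinner_le: "cmod (cinner z w) \<le> norm z * norm w"
proof -
  have "cmod (cinner z w) \<le> (\<Sum>j\<in>UNIV. cmod (z $ j) * cmod (w $ j))"
    unfolding cinner_def by (rule order_trans[OF norm_sum]) (simp add: norm_mult)
  also have "\<dots> \<le> norm z * norm w"
    using L2_set_mult_ineq[of "\<lambda>j. cmod (z $ j)" "\<lambda>j. cmod (w $ j)" UNIV] by (simp add: norm_vec_def)
  finally show ?thesis .
qed

lemma cinner_axis: "cinner z (axis j 1) = z $ j"
  by (simp add: cinner_def axis_def if_distrib cong: if_cong)

lemma norm_one_minus_cinner_ge:
  assumes "z \<in> unit_ball"
  shows "1 - norm w \<le> cmod (1 - cinner z w)"
proof -
  have "cmod (cinner z w) \<le> 1 * norm w"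
    using assms by (intro order_trans[OF norm_cinner_le] mult_right_mono) auto
  then show ?thesis using norm_triangle_ineq2[of 1 "cinner z w"] by simp
qed

lemma norm_cinner_less_1:
  assumes "z \<in> unit_ball" "w \<in> unit_ball"
  shows "cmod (cinner z w) < 1"
proof -
  have "cmod (cinner z w) \<le> 1 * norm w"
    using assms by (intro order_trans[OF norm_cinner_le] mult_right_mono) auto
  then show ?thesis using assms by simp
qed

lemma Re_one_minus_cinner_pos:
  assumes "z \<in> unit_ball" "w \<in> unit_ball"
  shows "Re (1 - cinner z w) > 0"
  using norm_cinner_less_1[OF assms] complex_Re_le_cmod[of "cinner z w"] by simp

lemma one_minus_cinner_nonzero:
  assumes "z \<in> unit_ball" "w \<in> unit_ball"
  shows "1 - cinner z w \<noteq> 0"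
  using Re_one_minus_cinner_pos[OF assms] by fastforce

lemma continuous_on_cinner_left:
  assumes "\<And>j. continuous_on S (\<lambda>w. g w $ j)"
  shows "continuous_on S (\<lambda>w. cinner (g w) z)"
  unfolding cinner_def by (intro continuous_intros assms)

section \<open>Principal powers in the right half-plane and the removal of the exponent\<close>

text \<open>The two arguments are below \<open>pi / 2\<close> in modulus, so their sum stays in the
  principal range and the logarithm is additive.\<close>

lemma powr_mult_right_half_plane:
  assumes "Re a > 0" "Re b > 0"
  shows "(a * b) powr s = a powr s * b powr s"
proof -
  have nz: "a \<noteq> 0" "b \<noteq> 0" using assms by auto
  then have "\<bar>Im (Ln a)\<bar> < pi / 2" "\<bar>Im (Ln b)\<bar> < pi / 2"
    using assms Re_Ln_pos_lt by auto
  then have "Ln (a * b) = Ln a + Ln b"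
    using nz by (intro Ln_times_simple) auto
  then show ?thesis using nz by (simp add: powr_def algebra_simps exp_add)
qed

lemma cnj_powr_real:
  assumes "Re a > 0"
  shows "cnj (a powr complex_of_real s) = cnj a powr complex_of_real s"
  using assms by (simp add: cnj_powr)

text \<open>The powers alone only determine the products up to a factor \<open>exp (2 * k * pi * \<i> / s)\<close>;
  since the logarithms are continuous on a connected set, their
  difference stays constant in the discrete set of periods.\<close>

lemma product_eq_if_powr_product_eq:
  fixes s :: real and a b c d :: "'a::topological_space \<Rightarrow> complex"
  assumes S: "connected S" and s: "s \<noteq> 0"
    and cont: "continuous_on S a" "continuous_on S b" "continuous_on S c" "continuous_on S d"
    and pos: "\<And>x. x \<in> S \<Longrightarrow> Re (a x) > 0" "\<And>x. x \<in> S \<Longrightarrow> Re (b x) > 0"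
      "\<And>x. x \<in> S \<Longrightarrow> Re (c x) > 0" "\<And>x. x \<in> S \<Longrightarrow> Re (d x) > 0"
    and eq: "\<And>x. x \<in> S \<Longrightarrow> a x powr of_real s * b x powr of_real s
      = c x powr of_real s * d x powr of_real s"
    and x0: "x0 \<in> S" "a x0 = d x0" "b x0 = c x0"
    and x: "x \<in> S"
  shows "a x * b x = c x * d x"
proof -
  define u where "u x = Ln (a x) + Ln (b x) - Ln (c x) - Ln (d x)" for x
  have nz: "a x \<noteq> 0" "b x \<noteq> 0" "c x \<noteq> 0" "d x \<noteq> 0" if "x \<in> S" for x
    using pos[OF that] by auto
  have notin: "z \<notin> \<real>\<^sub>\<le>\<^sub>0" if "Re z > 0" for z :: complex
    using that by (auto simp: complex_nonpos_Reals_iff)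
  have cont_u: "continuous_on S u"
    unfolding u_def by (intro continuous_intros cont) (use pos notin in blast)+
  have period: "\<exists>k::int. u y = of_real (2 * of_int k * pi / s) * \<i>" if "y \<in> S" for y
  proof -
    have "exp (of_real s * u y) = (a y powr of_real s * b y powr of_real s)
        / (c y powr of_real s * d y powr of_real s)"
      using nz[OF that] by (simp add: u_def powr_def algebra_simps exp_add exp_diff)
    also have "\<dots> = 1" using eq[OF that] nz[OF that] by simp
    finally obtain k :: int where k: "Re (of_real s * u y) = 0" "Im (of_real s * u y) = of_int (2 * k) * pi"
      unfolding exp_eq_1 by blast
    then have "u y = of_real (2 * of_int k * pi / s) * \<i>"
      using s by (auto simp: complex_eq_iff field_simps)
    then show ?thesis by blast
  qed
  have "u constant_on S"
  proof (rule continuous_discrete_range_constant[OF S cont_u])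
    fix x assume x: "x \<in> S"
    \<comment> \<open>Distinct values of \<open>u\<close> are distinct integer multiples of the
      period \<open>2 * pi / s\<close> times \<i>, so they are at least one period apart.\<close>
    have "2 * pi / \<bar>s\<bar> \<le> cmod (u y - u x)" if y: "y \<in> S" "u y \<noteq> u x" for y
    proof -
      obtain j k :: int where j: "u x = of_real (2 * of_int j * pi / s) * \<i>"
        and k: "u y = of_real (2 * of_int k * pi / s) * \<i>"
        using period x y by blast
      have "j \<noteq> k" using j k y(2) by auto
      then have "1 \<le> \<bar>k - j\<bar>"
        by simp
      then have "1 \<le> \<bar>of_int (k - j) :: real\<bar>"
        by linarith
      moreover have "u y - u x = of_real (of_int (k - j) * (2 * pi / s)) * \<i>"
        unfolding j k by (simp add: algebra_simps diff_divide_distrib)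
      then have "cmod (u y - u x) = \<bar>of_int (k - j)\<bar> * (2 * pi / \<bar>s\<bar>)"
        by (simp only: norm_mult norm_of_real norm_ii abs_mult abs_divide) simp
      ultimately show ?thesis
        using mult_right_mono[of 1 "\<bar>of_int (k - j) :: real\<bar>" "2 * pi / \<bar>s\<bar>"] by simp
    qed
    then show "\<exists>e>0. \<forall>y. y \<in> S \<and> u y \<noteq> u x \<longrightarrow> e \<le> cmod (u y - u x)"
      using s by (intro exI[of _ "2 * pi / \<bar>s\<bar>"]) auto
  qed
  \<comment> \<open>The value at \<open>x0\<close> is zero, since there \<open>a\<close> agrees with
    \<open>d\<close> and \<open>b\<close> with \<open>c\<close>.\<close>
  then have "u x = u x0" using x x0(1) unfolding constant_on_def by metis
  then have "Ln (a x) + Ln (b x) = Ln (c x) + Ln (d x)"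
    using x0 by (simp add: u_def algebra_simps)
  then have "exp (Ln (a x)) * exp (Ln (b x)) = exp (Ln (c x)) * exp (Ln (d x))"
    by (simp add: exp_add[symmetric])
  then show ?thesis using nz[OF x] by simp
qed

section \<open>Extension of symmetric maps from the ball to self-adjoint linear operators\<close>

lemma of_real_smult: "complex_of_real r *s z = r *\<^sub>R z"
proof -
  have "complex_of_real r * z $ i = r *\<^sub>R (z $ i)" for i by (simp add: scaleR_conv_of_real)
  then show ?thesis by (simp add: vec_eq_iff)
qed

lemma scaled_in_unit_ball:
  fixes z :: "complex ^ 'n"
  obtains t :: real where "t > 0" "complex_of_real t *s z \<in> unit_ball"
proof
  show "inverse (1 + norm z) > 0" by (simp add: add_pos_nonneg)
  have "complex_of_real (inverse (1 + norm z)) *s z = inverse (1 + norm z) *\<^sub>R z"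
    by (rule of_real_smult)
  moreover have "norm z / (1 + norm z) < 1"
    by (simp add: divide_less_eq add_pos_nonneg)
  ultimately show "complex_of_real (inverse (1 + norm z)) *s z \<in> unit_ball"
    by (simp add: divide_inverse mult.commute)
qed

text \<open>Symmetry expresses the coordinates of \<open>S w\<close> as pairings of \<open>w\<close>
  with fixed vectors, and these are linear in \<open>w\<close>.\<close>

lemma symmetric_on_ball_extends:
  fixes S :: "complex ^ 'n \<Rightarrow> complex ^ 'n"
  assumes sym: "\<And>z w. z \<in> unit_ball \<Longrightarrow> w \<in> unit_ball \<Longrightarrow> cinner (S w) z = cinner w (S z)"
  obtains A where "self_adjoint_linear A" "\<And>z. z \<in> unit_ball \<Longrightarrow> A z = S z"
proof
  \<comment> \<open>The basis vectors lie on the unit sphere; halving brings them into the open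
    ball, and the factor 2 in \<open>A\<close> undoes this.\<close>
  define e where "e j = complex_of_real (1/2) *s axis j (1::complex)" for j :: 'n
  have e: "e j \<in> unit_ball" for j
    unfolding e_def of_real_smult by simp
  define A :: "complex ^ 'n \<Rightarrow> complex ^ 'n" where "A w = (\<chi> j. 2 * cinner w (S (e j)))" for w
  show eq: "A w = S w" if "w \<in> unit_ball" for w
    using sym[OF e that] by (simp add: A_def vec_eq_iff e_def cinner_scale_right cinner_axis flip: sym[OF e that])
  have scale: "A (a *s w) = a *s A w" for a w
    by (simp add: A_def vec_eq_iff cinner_scale_left)
  have "Vector_Spaces.linear (*s) (*s) A"
    by unfold_locales
      (auto simp: A_def vec_eq_iff cinner_scale_left cinner_add_left algebra_simps)
  moreover have "cinner (A z) w = cinner z (A w)" for z w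
  proof -
    \<comment> \<open>Both vectors are scaled into the ball, where \<open>A\<close> is
      \<open>S\<close>; the positive real factors then cancel by homogeneity.\<close>
    obtain s where s: "s > 0" "complex_of_real s *s z \<in> unit_ball" using scaled_in_unit_ball .
    obtain t where t: "t > 0" "complex_of_real t *s w \<in> unit_ball" using scaled_in_unit_ball .
    have "cinner (A (of_real s *s z)) (of_real t *s w) = cinner (of_real s *s z) (A (of_real t *s w))"
      using sym[OF t(2) s(2)] eq s t by simp
    then show ?thesis using s t by (simp add: scale cinner_scale_left cinner_scale_right)
  qed
  ultimately show "self_adjoint_linear A" by (simp add: self_adjoint_linear_def)
qed

lemma ball_kernel_ball:
  "w \<in> unit_ball \<Longrightarrow> ball_kernel \<gamma> z w = (1 - cinner w z) powr (- complex_of_real \<gamma>)"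
  by (simp add: ball_kernel_def)

section \<open>Linear fractional symbols give symmetric weighted compositions\<close>

text \<open>With denominators cleared, both sides become
  \<open>1 - cinner w c - cinner c z - cinner (A w) z\<close>.\<close>

lemma linear_fractional_symmetry:
  assumes sa: "self_adjoint_linear A"
    and c: "c \<in> unit_ball" and z: "z \<in> unit_ball" and w: "w \<in> unit_ball"
    and \<phi>: "\<And>z. z \<in> unit_ball \<Longrightarrow> \<phi> z = (1 / (1 - cinner z c)) *s (c + A z)"
  shows "(1 - cinner w c) * (1 - cinner (\<phi> w) z) = (1 - cinner c z) * (1 - cinner w (\<phi> z))"
proof -
  have eq: "(1 - cinner v c) *s \<phi> v = c + A v" if "v \<in> unit_ball" for v
    using \<phi>[OF that] one_minus_cinner_nonzero[OF that c] by (simp add: vector_smult_assoc)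
  have "(1 - cinner w c) * cinner (\<phi> w) z = cinner c z + cinner (A w) z"
    unfolding cinner_scale_left[symmetric] eq[OF w] by (rule cinner_add_left)
  moreover have "(1 - cinner c z) * cinner w (\<phi> z) = cinner w ((1 - cinner z c) *s \<phi> z)"
    by (simp only: cinner_scale_right complex_cnj_diff complex_cnj_one cnj_cinner)
  then have "(1 - cinner c z) * cinner w (\<phi> z) = cinner w c + cinner w (A z)"
    unfolding eq[OF z] cinner_add_right .
  moreover have "cinner (A w) z = cinner w (A z)"
    using sa by (simp add: self_adjoint_linear_def)
  ultimately show ?thesis by (simp only: right_diff_distrib mult_1_right) simp
qed

text \<open>Taking \<open>w = \<phi> z\<close> in the symmetry relation produces \<open>1 - (norm (\<phi> z))\<^sup>2\<close>, which
  replaces an appeal to the Schwarz-Pick lemma.\<close>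

lemma norm_gap_if_symmetric:
  assumes c: "c \<in> unit_ball" and z: "z \<in> unit_ball"
    and self: "\<And>z. z \<in> unit_ball \<Longrightarrow> \<phi> z \<in> unit_ball"
    and sym: "\<And>z w. z \<in> unit_ball \<Longrightarrow> w \<in> unit_ball \<Longrightarrow>
      (1 - cinner w c) * (1 - cinner (\<phi> w) z) = (1 - cinner c z) * (1 - cinner w (\<phi> z))"
  shows "(1 - norm c) / 4 * (1 - norm z) \<le> 1 - norm (\<phi> z)"
proof -
  have nz: "norm z < 1" and nc: "norm c < 1" and np: "norm (\<phi> z) < 1"
    using c z self by auto
  have "1 - cinner (\<phi> z) (\<phi> z) = of_real (1 - (norm (\<phi> z))\<^sup>2)"
    by (simp add: cinner_self)
  then have "cmod (1 - cinner (\<phi> z) (\<phi> z)) = 1 - (norm (\<phi> z))\<^sup>2"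
    using np by (simp only: norm_of_real) (simp add: power_le_one)
  moreover have "(1 - norm c) * (1 - norm z)
      \<le> cmod (1 - cinner (\<phi> z) c) * cmod (1 - cinner (\<phi> (\<phi> z)) z)"
    using nc nz norm_one_minus_cinner_ge self z by (intro mult_mono) auto
  \<comment> \<open>The 4 in the conclusion is this 2 times the bound 2 for
    \<open>1 + norm (\<phi> z)\<close> below.\<close>
  moreover have "cmod (1 - cinner c z) \<le> 2"
    using norm_triangle_ineq4[of 1 "cinner c z"] norm_cinner_less_1[OF c z] by simp
  then have "cmod (1 - cinner c z) * (1 - (norm (\<phi> z))\<^sup>2) \<le> 2 * (1 - (norm (\<phi> z))\<^sup>2)"
    using np by (intro mult_right_mono) (auto simp: power_le_one)
  ultimately have "(1 - norm c) * (1 - norm z) \<le> 2 * (1 - (norm (\<phi> z))\<^sup>2)"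
    using arg_cong[OF sym[OF z self[OF z]], of cmod] by (simp only: norm_mult)
  also have "1 - (norm (\<phi> z))\<^sup>2 = (1 - norm (\<phi> z)) * (1 + norm (\<phi> z))"
    by (simp add: power2_eq_square algebra_simps)
  also have "2 * \<dots> \<le> 2 * ((1 - norm (\<phi> z)) * 2)"
    using np by (intro mult_left_mono) auto
  finally show ?thesis by simp
qed

text \<open>The squared norm of a kernel is its value at its own base point. The free parameter
  \<open>d\<close> receives the geometric lower bound along an orbit.\<close>

lemma ip_norm_ball_kernel_le:
  assumes rk: "reproducing_kernel_hilbert_space unit_ball H ip (ball_kernel \<gamma>)"
    and \<gamma>: "\<gamma> > 0" and z: "z \<in> unit_ball" and d: "0 < d" "d \<le> 1 - norm z"
  shows "ip_norm ip (ball_kernel \<gamma> z) \<le> sqrt (d powr (- \<gamma>))"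
proof -
  interpret reproducing_kernel_hilbert_space unit_ball H ip "ball_kernel \<gamma>" by (rule rk)
  have nz: "norm z < 1" using z by simp
  \<comment> \<open>This passes from \<open>1 - norm z\<close> to the larger
    \<open>1 - (norm z)\<^sup>2\<close>; the negative exponent later reverses the order.\<close>
  have "(norm z)\<^sup>2 \<le> norm z" using nz by (simp add: power2_eq_square mult_left_le)
  then have dle: "d \<le> 1 - (norm z)\<^sup>2" using d by simp
  have "ip (ball_kernel \<gamma> z) (ball_kernel \<gamma> z) = (1 - cinner z z) powr (- complex_of_real \<gamma>)"
    using reproducing[OF z kernel_mem[OF z]] ball_kernel_ball[OF z] by simp
  also have "\<dots> = complex_of_real (1 - (norm z)\<^sup>2) powr complex_of_real (- \<gamma>)"
    by (simp add: cinner_self)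
  also have "\<dots> = complex_of_real ((1 - (norm z)\<^sup>2) powr (- \<gamma>))"
    using dle d by (intro powr_of_real[symmetric] powr_of_real) auto
  finally have "ip_norm ip (ball_kernel \<gamma> z) = sqrt ((1 - (norm z)\<^sup>2) powr (- \<gamma>))"
    by (simp add: ip_norm_def)
  also have "\<dots> \<le> sqrt (d powr (- \<gamma>))"
    using dle d \<gamma> by (intro real_sqrt_le_mono powr_mono2') auto
  finally show ?thesis .
qed

text \<open>The weight bound comes from \<open>cmod (1 - cinner z c) \<ge> 1 - norm c\<close>. The
  rate comes from \<open>norm_gap_if_symmetric\<close>; its square root reflects that the kernel at
  its base point is a squared norm.\<close>

lemma symmetric_if_linear_fractional:
  fixes \<alpha> :: real
  assumes \<gamma>: "\<gamma> > 0"
    and rk: "reproducing_kernel_hilbert_space unit_ball H ip (ball_kernel \<gamma>)"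
    and c: "c \<in> unit_ball" and sa: "self_adjoint_linear A" and \<alpha>: "\<alpha> \<noteq> 0"
    and self: "\<And>z. z \<in> unit_ball \<Longrightarrow> \<phi> z \<in> unit_ball"
    and f: "\<And>z. z \<in> unit_ball \<Longrightarrow> f z = complex_of_real \<alpha> * ball_kernel \<gamma> c z"
    and \<phi>: "\<And>z. z \<in> unit_ball \<Longrightarrow> \<phi> z = (1 / (1 - cinner z c)) *s (c + A z)"
  shows "symmetric_weighted_composition unit_ball H ip (ball_kernel \<gamma>) f \<phi>
    (\<bar>\<alpha>\<bar> * (1 - norm c) powr (- \<gamma>)) (sqrt (((1 - norm c) / 4) powr (- \<gamma>)))"
proof -
  interpret reproducing_kernel_hilbert_space unit_ball H ip "ball_kernel \<gamma>" by (rule rk)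
  have nc: "norm c < 1" using c by simp
  define r where "r = (1 - norm c) / 4"
  have r: "r > 0" using nc by (simp add: r_def)
  note prod = linear_fractional_symmetry[where \<phi> = \<phi>, OF sa c _ _ \<phi>]
  have gap: "r * (1 - norm z) \<le> 1 - norm (\<phi> z)" if "z \<in> unit_ball" for z
    unfolding r_def by (rule norm_gap_if_symmetric[where \<phi> = \<phi>, OF c that self prod])
  show ?thesis
  proof unfold_locales
    show "\<phi> z \<in> unit_ball" if "z \<in> unit_ball" for z using self[OF that] .
  next
    fix z w :: "complex ^ 'a" assume z: "z \<in> unit_ball" and w: "w \<in> unit_ball"
    have "f w * ball_kernel \<gamma> z (\<phi> w)
        = of_real \<alpha> * ((1 - cinner w c) * (1 - cinner (\<phi> w) z)) powr (- of_real \<gamma>)"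
      unfolding powr_mult_right_half_plane[OF Re_one_minus_cinner_pos[OF w c]
          Re_one_minus_cinner_pos[OF self[OF w] z]]
      by (simp add: f[OF w] ball_kernel_ball[OF w] ball_kernel_ball[OF self[OF w]])
    also have "\<dots> = of_real \<alpha> * ((1 - cinner c z) * (1 - cinner w (\<phi> z))) powr (- of_real \<gamma>)"
      using prod[OF z w] by simp
    also have "\<dots> = of_real \<alpha> * ((1 - cinner c z) powr (- of_real \<gamma>)
        * (1 - cinner w (\<phi> z)) powr (- of_real \<gamma>))"
      unfolding powr_mult_right_half_plane[OF Re_one_minus_cinner_pos[OF c z]
          Re_one_minus_cinner_pos[OF w self[OF z]]] ..
    also have "(1 - cinner c z) powr (- of_real \<gamma>) = cnj ((1 - cinner z c) powr (- of_real \<gamma>))"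
      using cnj_powr_real[OF Re_one_minus_cinner_pos[OF z c], of "- \<gamma>"] by (simp add: cnj_cinner)
    finally show "f w * ball_kernel \<gamma> z (\<phi> w) = cnj (f z) * ball_kernel \<gamma> (\<phi> z) w"
      using z w by (simp add: f ball_kernel_ball)
  next
    fix z :: "complex ^ 'a" assume z: "z \<in> unit_ball"
    have "cmod (f z) = \<bar>\<alpha>\<bar> * cmod (1 - cinner z c) powr (- \<gamma>)"
      using norm_powr_real_powr'[of "- complex_of_real \<gamma>" "1 - cinner z c"]
      by (simp add: f[OF z] ball_kernel_ball[OF z] norm_mult)
    also have "\<dots> \<le> \<bar>\<alpha>\<bar> * (1 - norm c) powr (- \<gamma>)"
      using \<gamma> nc norm_one_minus_cinner_ge[OF z] by (intro mult_left_mono powr_mono2') auto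
    finally show "cmod (f z) \<le> \<bar>\<alpha>\<bar> * (1 - norm c) powr (- \<gamma>)" .
  next
    show "0 < \<bar>\<alpha>\<bar> * (1 - norm c) powr (- \<gamma>)" using \<alpha> nc by simp
    show "0 < sqrt (((1 - norm c) / 4) powr (- \<gamma>))" using nc by simp
  next
    fix z :: "complex ^ 'a" assume z: "z \<in> unit_ball"
    then have nz: "norm z < 1" by simp
    \<comment> \<open>Iterating the gap estimate lets the orbit approach the sphere at most
      geometrically, with a ratio \<open>r\<close> that depends only on \<open>c\<close>.\<close>
    have orbit: "(\<phi> ^^ m) z \<in> unit_ball \<and> r ^ m * (1 - norm z) \<le> 1 - norm ((\<phi> ^^ m) z)" for m
    proof (induction m)
      case (Suc m)
      have "r * (r ^ m * (1 - norm z)) \<le> r * (1 - norm ((\<phi> ^^ m) z))"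
        using Suc r by (intro mult_left_mono) auto
      also have "\<dots> \<le> 1 - norm (\<phi> ((\<phi> ^^ m) z))" using gap Suc by blast
      finally show ?case using Suc self by simp
    qed (use z in simp)
    have "ip_norm ip (ball_kernel \<gamma> ((\<phi> ^^ m) z))
        \<le> sqrt ((1 - norm z) powr (- \<gamma>)) * sqrt (r powr (- \<gamma>)) ^ m" for m
    proof -
      have "ip_norm ip (ball_kernel \<gamma> ((\<phi> ^^ m) z)) \<le> sqrt ((r ^ m * (1 - norm z)) powr (- \<gamma>))"
        using orbit r nz by (intro ip_norm_ball_kernel_le[OF rk \<gamma>]) auto
      also have "(r ^ m * (1 - norm z)) powr (- \<gamma>) = (r powr (- \<gamma>)) ^ m * (1 - norm z) powr (- \<gamma>)"
        using r nz by (simp add: powr_mult powr_realpow[symmetric] powr_powr mult.commute)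
      finally show ?thesis by (simp add: real_sqrt_mult real_sqrt_power mult.commute)
    qed
    then show "\<exists>C. \<forall>m. ip_norm ip (ball_kernel \<gamma> ((\<phi> ^^ m) z))
        \<le> C * sqrt (((1 - norm c) / 4) powr (- \<gamma>)) ^ m"
      unfolding r_def by blast
  qed
qed

section \<open>Self-adjointness forces the linear fractional form\<close>

text \<open>Self-adjointness is applied to the kernels at \<open>z\<close> and \<open>w\<close>, and
  the reproducing property evaluates both sides.\<close>

lemma kernel_relation_if_symmetric:
  assumes rk: "reproducing_kernel_hilbert_space unit_ball H ip (ball_kernel \<gamma>)"
    and bdd: "bounded_operator_on H ip (weighted_composition f \<phi>)"
    and sa: "self_adjoint_operator_on H ip (weighted_composition f \<phi>)"
    and self: "\<And>z. z \<in> unit_ball \<Longrightarrow> \<phi> z \<in> unit_ball"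
    and z: "z \<in> unit_ball" and w: "w \<in> unit_ball"
  shows "f w * ball_kernel \<gamma> z (\<phi> w) = cnj (f z) * ball_kernel \<gamma> (\<phi> z) w"
proof -
  interpret reproducing_kernel_hilbert_space unit_ball H ip "ball_kernel \<gamma>" by (rule rk)
  let ?W = "weighted_composition f \<phi>"
  have mem: "?W (ball_kernel \<gamma> v) \<in> H" if "v \<in> unit_ball" for v
    using bdd kernel_mem[OF that] by (simp add: bounded_operator_on_def)
  have "?W (ball_kernel \<gamma> z) w = ip (?W (ball_kernel \<gamma> z)) (ball_kernel \<gamma> w)"
    using reproducing[OF w mem[OF z]] by simp
  also have "\<dots> = ip (ball_kernel \<gamma> z) (?W (ball_kernel \<gamma> w))"
    using sa kernel_mem z w by (simp add: self_adjoint_operator_on_def)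
  also have "\<dots> = cnj (?W (ball_kernel \<gamma> w) z)"
    using ip_commute[OF mem[OF w] kernel_mem[OF z]] reproducing[OF z mem[OF w]] by simp
  finally show ?thesis
    using z w kernel_commute[OF w self[OF z]] by (simp add: weighted_composition_def)
qed

lemma linear_fractional_if_symmetric:
  fixes \<phi> :: "complex ^ 'n \<Rightarrow> complex ^ 'n"
  assumes \<gamma>: "\<gamma> > 0"
    and self: "\<And>z. z \<in> unit_ball \<Longrightarrow> \<phi> z \<in> unit_ball"
    and cont: "\<And>j. continuous_on unit_ball (\<lambda>z. \<phi> z $ j)"
    and rel: "\<And>z w. z \<in> unit_ball \<Longrightarrow> w \<in> unit_ball \<Longrightarrow>
      f w * ball_kernel \<gamma> z (\<phi> w) = cnj (f z) * ball_kernel \<gamma> (\<phi> z) w"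
    and nz: "z0 \<in> unit_ball" "f z0 \<noteq> 0"
  obtains A \<alpha> where "self_adjoint_linear A" "\<alpha> \<noteq> (0::real)"
    "\<And>z. z \<in> unit_ball \<Longrightarrow> f z = complex_of_real \<alpha> * ball_kernel \<gamma> (\<phi> 0) z"
    "\<And>z. z \<in> unit_ball \<Longrightarrow> \<phi> z = (1 / (1 - cinner z (\<phi> 0))) *s (\<phi> 0 + A z)"
proof -
  have 0: "(0 :: complex ^ 'n) \<in> unit_ball" by simp
  define c where "c = \<phi> 0"
  \<comment> \<open>The kernel at 0 is constantly 1 on the ball, so the relation with
    \<open>z = 0\<close> determines \<open>f\<close>.\<close>
  have c: "c \<in> unit_ball" unfolding c_def using self[OF 0] .
  have f_eq: "f w = cnj (f 0) * ball_kernel \<gamma> c w" if "w \<in> unit_ball" for w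
    using rel[OF 0 that] ball_kernel_ball[OF self[OF that], of \<gamma> 0] by (simp add: c_def)
  \<comment> \<open>Every kernel takes the value 1 at the origin, which makes \<open>f 0\<close>
    real.\<close>
  have "f 0 = cnj (f 0)" using f_eq[OF 0] ball_kernel_ball[OF 0, of \<gamma> c] by simp
  then obtain \<alpha> :: real where \<alpha>: "f 0 = of_real \<alpha>" by (metis Reals_cases Reals_cnj_iff)
  have \<alpha>_nz: "\<alpha> \<noteq> 0" using f_eq[OF nz(1)] nz(2) \<alpha> by auto
  have f: "f w = of_real \<alpha> * (1 - cinner w c) powr of_real (- \<gamma>)" if "w \<in> unit_ball" for w
    using f_eq[OF that] \<alpha> ball_kernel_ball[OF that] by simp
  have prod: "(1 - cinner w c) * (1 - cinner (\<phi> w) z) = (1 - cinner c z) * (1 - cinner w (\<phi> z))"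
    if z: "z \<in> unit_ball" and w: "w \<in> unit_ball" for z w
  \<comment> \<open>The relation is read as one in \<open>w\<close> on the connected ball. The base
    point is 0: there the first and fourth factors are 1, and the second equals the third because
    \<open>c = \<phi> 0\<close>.\<close>
  proof (rule product_eq_if_powr_product_eq[of unit_ball "- \<gamma>" "\<lambda>w. 1 - cinner w c"
        "\<lambda>w. 1 - cinner (\<phi> w) z" "\<lambda>w. 1 - cinner c z" "\<lambda>w. 1 - cinner w (\<phi> z)" 0])
    fix v :: "complex ^ 'n" assume v: "v \<in> unit_ball"
    have "cnj (f z) = of_real \<alpha> * (1 - cinner c z) powr of_real (- \<gamma>)"
      using f[OF z] cnj_powr_real[OF Re_one_minus_cinner_pos[OF z c], of "- \<gamma>"]
      by (simp add: cnj_cinner)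
    then show "(1 - cinner v c) powr of_real (- \<gamma>) * (1 - cinner (\<phi> v) z) powr of_real (- \<gamma>)
        = (1 - cinner c z) powr of_real (- \<gamma>) * (1 - cinner v (\<phi> z)) powr of_real (- \<gamma>)"
      using rel[OF z v] f[OF v] \<alpha>_nz ball_kernel_ball[OF v] ball_kernel_ball[OF self[OF v]] by simp
  next
    show "continuous_on unit_ball (\<lambda>w. 1 - cinner w c)"
      "continuous_on unit_ball (\<lambda>w. 1 - cinner (\<phi> w) z)"
      "continuous_on unit_ball (\<lambda>w. 1 - cinner w (\<phi> z))"
      by (intro continuous_intros continuous_on_cinner_left cont)+
    show "0 < Re (1 - cinner w c)" "0 < Re (1 - cinner (\<phi> w) z)"
      "0 < Re (1 - cinner c z)" "0 < Re (1 - cinner w (\<phi> z))" if "w \<in> unit_ball" for w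
      using that z c self Re_one_minus_cinner_pos by blast+
  qed (use \<gamma> w in \<open>auto simp: c_def\<close>)
  \<comment> \<open>Solving the desired formula for \<open>A z\<close> gives \<open>S z\<close>;
    expanding \<open>prod\<close> and cancelling common terms is exactly its symmetry.\<close>
  define S where "S z = (1 - cinner z c) *s \<phi> z - c" for z
  have "cinner (S w) z = cinner w (S z)" if "z \<in> unit_ball" "w \<in> unit_ball" for z w
    using prod[OF that]
    unfolding S_def cinner_diff_left cinner_diff_right cinner_scale_left cinner_scale_right
    by (simp add: cnj_cinner algebra_simps)
  then obtain A where A: "self_adjoint_linear A" "\<And>z. z \<in> unit_ball \<Longrightarrow> A z = S z"
    using symmetric_on_ball_extends[of S] by blast
  show ?thesis
  proof (rule that[OF A(1) \<alpha>_nz])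
    fix z :: "complex ^ 'n" assume z: "z \<in> unit_ball"
    show "f z = of_real \<alpha> * ball_kernel \<gamma> (\<phi> 0) z"
      using f_eq[OF z] \<alpha> by (simp add: c_def)
    have "c + A z = (1 - cinner z c) *s \<phi> z" using A(2)[OF z] by (simp add: S_def)
    then have "(1 / (1 - cinner z c)) *s (c + A z) = \<phi> z"
      using one_minus_cinner_nonzero[OF z c] by (simp only: vector_smult_assoc) simp
    then show "\<phi> z = (1 / (1 - cinner z (\<phi> 0))) *s (\<phi> 0 + A z)"
      by (simp add: c_def)
  qed
qed

section \<open>The equivalence\<close>

lemma analytic_several_imp_continuous_on:
  assumes "analytic_several f S"
  shows "continuous_on S f"
  using assms has_derivative_continuous
  by (intro continuous_at_imp_continuous_on ballI) (fastforce simp: analytic_several_def)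

theorem corollary5p4:
  fixes \<gamma> :: real
    and H :: "(complex ^ 'n \<Rightarrow> complex) set"
    and ip :: "(complex ^ 'n \<Rightarrow> complex) \<Rightarrow> (complex ^ 'n \<Rightarrow> complex) \<Rightarrow> complex"
    and f :: "complex ^ 'n \<Rightarrow> complex"
    and \<phi> :: "complex ^ 'n \<Rightarrow> complex ^ 'n"
  assumes "\<gamma> > 0"
    and "is_H_gamma \<gamma> H ip"
    and "analytic_several f unit_ball"
    and "analytic_self_map \<phi>"
  shows "bounded_operator_on H ip (weighted_composition f \<phi>) \<and>
         self_adjoint_operator_on H ip (weighted_composition f \<phi>) \<and>
         nonzero_operator_on H (weighted_composition f \<phi>)
     \<longleftrightarrow>
         (\<exists>c A \<alpha>. c \<in> unit_ball \<and> self_adjoint_linear A \<and> \<alpha> \<noteq> (0::real) \<and>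
            (\<forall>z\<in>unit_ball. f z = complex_of_real \<alpha> * ball_kernel \<gamma> c z) \<and>
            (\<forall>z\<in>unit_ball. f z = complex_of_real \<alpha> * ball_kernel \<gamma> (\<phi> 0) z) \<and>
            (\<forall>z\<in>unit_ball. \<phi> z = (1 / (1 - cinner z c)) *s (c + A z)))"
    (is "?L \<longleftrightarrow> ?R")
proof
  have rk: "reproducing_kernel_hilbert_space unit_ball H ip (ball_kernel \<gamma>)"
    using assms(2) by (simp add: is_H_gamma_def)
  interpret reproducing_kernel_hilbert_space unit_ball H ip "ball_kernel \<gamma>" by (rule rk)
  have self: "\<phi> z \<in> unit_ball" if "z \<in> unit_ball" for z
    using assms(4) that unfolding analytic_self_map_def by blast
  have 0: "(0 :: complex ^ 'n) \<in> unit_ball" by simp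
  {
    assume L: ?L
    have "\<exists>z\<in>unit_ball. f z \<noteq> 0"
    proof (rule ccontr)
      assume "\<not> ?thesis"
      then have "weighted_composition f \<phi> h = (\<lambda>x. 0)" for h
        by (auto simp: weighted_composition_def)
      then show False using L by (simp add: nonzero_operator_on_def)
    qed
    then obtain z0 where z0: "z0 \<in> unit_ball" "f z0 \<noteq> 0" by blast
    have "continuous_on unit_ball (\<lambda>z. \<phi> z $ j)" for j
      using assms(4) analytic_several_imp_continuous_on unfolding analytic_self_map_def by blast
    moreover have "f w * ball_kernel \<gamma> z (\<phi> w) = cnj (f z) * ball_kernel \<gamma> (\<phi> z) w"
      if "z \<in> unit_ball" "w \<in> unit_ball" for z w
      using L kernel_relation_if_symmetric[where \<phi> = \<phi>, OF rk _ _ self that] by blast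
    ultimately obtain A \<alpha> where "self_adjoint_linear A" "\<alpha> \<noteq> (0::real)"
      "\<And>z. z \<in> unit_ball \<Longrightarrow> f z = complex_of_real \<alpha> * ball_kernel \<gamma> (\<phi> 0) z"
      "\<And>z. z \<in> unit_ball \<Longrightarrow> \<phi> z = (1 / (1 - cinner z (\<phi> 0))) *s (\<phi> 0 + A z)"
      using linear_fractional_if_symmetric[where \<phi> = \<phi> and f = f, OF assms(1) self _ _ z0] by metis
    \<comment> \<open>The witness for \<open>c\<close> is \<open>\<phi> 0\<close>, so the two
      formulas for \<open>f\<close> coincide.\<close>
    then show ?R using self[OF 0] by blast
  next
    assume ?R
    then obtain c A \<alpha> where c: "c \<in> unit_ball" and A: "self_adjoint_linear A" and \<alpha>: "\<alpha> \<noteq> (0::real)"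
      and f: "\<And>z. z \<in> unit_ball \<Longrightarrow> f z = complex_of_real \<alpha> * ball_kernel \<gamma> c z"
      and \<phi>: "\<And>z. z \<in> unit_ball \<Longrightarrow> \<phi> z = (1 / (1 - cinner z c)) *s (c + A z)"
      by blast
    interpret W: symmetric_weighted_composition unit_ball H ip "ball_kernel \<gamma>" f \<phi>
      "\<bar>\<alpha>\<bar> * (1 - norm c) powr (- \<gamma>)" "sqrt (((1 - norm c) / 4) powr (- \<gamma>))"
      by (rule symmetric_if_linear_fractional[where \<phi> = \<phi> and f = f, OF assms(1) rk c A \<alpha> self f \<phi>])
    have W: "weighted_composition f \<phi> = W.W"
      by (simp add: fun_eq_iff weighted_composition_def W.W_def)
    \<comment> \<open>The kernel at 0 witnesses that the operator is nonzero: its image is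
      \<open>f\<close> on the ball, with value \<alpha> at the origin.\<close>
    have "W.W (ball_kernel \<gamma> 0) 0 = of_real \<alpha>"
      using ball_kernel_ball[OF self[OF 0], of \<gamma> 0] ball_kernel_ball[OF 0, of \<gamma> c]
      by (simp add: W.W_def f[OF 0])
    then have "W.W (ball_kernel \<gamma> 0) \<noteq> (\<lambda>x. 0)" using \<alpha> by auto
    then have "nonzero_operator_on H W.W"
      unfolding nonzero_operator_on_def using kernel_mem[OF 0] by blast
    then show ?L unfolding W using W.bounded_W W.self_adjoint_W by blast
  }
qed

end
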